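(* Let $X$ be a finite-dimensional real Hilbert space, let $m\in\mathbb{N}$, $I:=\{1,2,\ldots,m\}$, and let $\{T_i\}_{i\in I}$ be continuous cutters defined on $X$ with fixed point sets $F_i:=\mathrm{Fix}(T_i)$ and common fixed point set $F:=\bigcap_{i\in I}F_i\neq\emptyset$. Let $\{w_k\}_{k=0}^{\infty}$ be a sequence of weight functions on $I$, let $\tau_1,\tau_2\in(0,1]$, let $x^0\in X$ be arbitrary, and let $\{x^k\}_{k=0}^{\infty}$ be a sequence satisfying, for all $k\in\mathbb{N}\cup\{0\}$, $$x^{k+1}=T_{w_k,\lambda_k}(x^k)=x^k+\lambda_k\Big(\sum_{i\in I}w_k(i)T_i(x^k)-x^k\Big),$$ where $\lambda_k\in[\tau_1,(2-\tau_2)L(x^k,w_k)]$ for all $k\in\mathbb{N}\cup\{0\}$. If the interior of $F$ is nonempty and $\sum_{k=0}^{\infty}w_k(i)=\infty$ for all $i\in I$, then $\{x^k\}_{k=0}^{\infty}$ converges to a point $x^{\ast}\in F$.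
   Context: An operator $T:X\to X$ on a real Hilbert space is called a cutter if $\mathrm{Fix}(T):=\{x\in X\mid T(x)=x\}\neq\emptyset$ and $\langle x-T(x),q-T(x)\rangle\le 0$ for all $x\in X$ and all $q\in\mathrm{Fix}(T)$. A weight function on $I=\{1,\ldots,m\}$ is a function $w:I\to[0,1]$ with $\sum_{i\in I}w(i)=1$. For a weight function $w$ and operators $T_i:X\to X$, $i\in I$, put $T_w(x):=\sum_{i\in I}w(i)T_i(x)$ and, for $\lambda\in\mathbb{R}$, $T_{w,\lambda}(x):=x+\lambda(T_w(x)-x)$. Define $L(x,w):=\dfrac{\sum_{i\in I}w(i)\|T_i(x)-x\|^2}{\|T_w(x)-x\|^2}$ if $T_w(x)\neq x$, and $L(x,w):=1$ otherwise. *)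

theory Defs
  imports "HOL-Analysis.Analysis"
begin

definition Fix :: "('a \<Rightarrow> 'a) \<Rightarrow> 'a set" where
  "Fix T = {x. T x = x}"

definition cutter :: "('a::real_inner \<Rightarrow> 'a) \<Rightarrow> bool" where
  "cutter T \<longleftrightarrow> Fix T \<noteq> {} \<and> (\<forall>x. \<forall>q\<in>Fix T. inner (x - T x) (q - T x) \<le> 0)"

text \<open>Weights and families of operators are total functions; only their values on the
  index set \<open>I\<close> are constrained or used.\<close>

definition weight_function :: "'i set \<Rightarrow> ('i \<Rightarrow> real) \<Rightarrow> bool" where
  "weight_function I w \<longleftrightarrow> (\<forall>i\<in>I. w i \<in> {0..1}) \<and> (\<Sum>i\<in>I. w i) = 1"

definition weighted_op ::
  "'i set \<Rightarrow> ('i \<Rightarrow> 'a \<Rightarrow> 'a::real_vector) \<Rightarrow> ('i \<Rightarrow> real) \<Rightarrow> 'a \<Rightarrow> 'a" where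
  "weighted_op I T w x = (\<Sum>i\<in>I. w i *\<^sub>R T i x)"

definition relaxed_op ::
  "'i set \<Rightarrow> ('i \<Rightarrow> 'a \<Rightarrow> 'a::real_vector) \<Rightarrow> ('i \<Rightarrow> real) \<Rightarrow> real \<Rightarrow> 'a \<Rightarrow> 'a" where
  "relaxed_op I T w lam x = x + lam *\<^sub>R (weighted_op I T w x - x)"

definition extrapolation_bound ::
  "'i set \<Rightarrow> ('i \<Rightarrow> 'a \<Rightarrow> 'a::real_normed_vector) \<Rightarrow> 'a \<Rightarrow> ('i \<Rightarrow> real) \<Rightarrow> real" where
  "extrapolation_bound I T x w =
    (if weighted_op I T w x \<noteq> x
     then (\<Sum>i\<in>I. w i * (norm (T i x - x))\<^sup>2) / (norm (weighted_op I T w x - x))\<^sup>2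
     else 1)"

end

theory Submission
  imports Defs
begin

text \<open>
  A cutter moves every point towards each of its fixed points: the inner product of the
  displacement \<open>T y - y\<close> with \<open>q - y\<close> is at least the squared length of the displacement.  The
  property survives averaging, and the extrapolation bound is the quotient for which even an
  overlong step along the averaged displacement still decreases the squared distance to every
  common fixed point, by a fixed fraction of the weighted sum of the squared displacements
  (\<open>relaxed_op_decrease\<close>).  Two consequences are combined.

  First, the iterates come closer to \<^emph>\<open>all\<close> points of a ball around an interior point \<open>z\<close>
  of \<open>F\<close>.  Testing this against the point of the ball that lies furthest back, opposite to the
  current step, bounds the length of the step, and not merely its square, by the decrease of the
  squared distance to \<open>z\<close> (\<open>step_le_decrease\<close>).  These decreases telescope, so the path has
  finite length and converges to some \<open>x'\<close>.

  Second, the weighted sums of squared displacements are summable over all steps.  If \<open>T\<^sub>i\<close>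
  moved \<open>x'\<close>, then by continuity it would move all late iterates by at least a fixed amount, so
  the weights of \<open>T\<^sub>i\<close> would be summable as well, whereas their sum is infinite.  Hence
  \<open>x'\<close> is fixed by every \<open>T\<^sub>i\<close>.
\<close>

lemma cutter_displacement:
  assumes "cutter T" "q \<in> Fix T"
  shows "(norm (T y - y))\<^sup>2 \<le> inner (T y - y) (q - y)"
proof -
  have "inner (y - T y) (q - T y) \<le> 0"
    using assms by (auto simp: cutter_def)
  then show ?thesis
    by (simp add: power2_norm_eq_inner inner_diff_left inner_diff_right inner_commute)
qed

lemma weighted_op_displacement:
  assumes "weight_function I w"
  shows "weighted_op I T w y - y = (\<Sum>i\<in>I. w i *\<^sub>R (T i y - y))"
proof -
  have "(\<Sum>i\<in>I. w i *\<^sub>R y) = y"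
    using assms by (simp add: weight_function_def flip: scaleR_left.sum)
  then show ?thesis
    by (simp add: weighted_op_def scaleR_diff_right sum_subtractf)
qed

lemma weighted_op_displacement_inner:
  assumes "\<And>i. i \<in> I \<Longrightarrow> cutter (T i)" "weight_function I w" "\<And>i. i \<in> I \<Longrightarrow> q \<in> Fix (T i)"
  shows "(\<Sum>i\<in>I. w i * (norm (T i y - y))\<^sup>2) \<le> inner (weighted_op I T w y - y) (q - y)"
  unfolding weighted_op_displacement[OF assms(2)] inner_sum_left inner_scaleR_left
  using assms by (intro sum_mono mult_left_mono cutter_displacement) (auto simp: weight_function_def)

text \<open>
  Expanding the square leaves a negative linear and a positive quadratic term in the
  step parameter \<open>\<alpha>\<close>; the bound on \<open>\<alpha>\<close> makes the quadratic term at most the fraction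
  \<open>(2 - \<tau>) / 2\<close> of what the linear one is guaranteed to take away.
\<close>

lemma relaxed_op_decrease:
  assumes cut: "\<And>i. i \<in> I \<Longrightarrow> cutter (T i)" and w: "weight_function I w"
    and q: "\<And>i. i \<in> I \<Longrightarrow> q \<in> Fix (T i)"
    and lam: "0 \<le> \<alpha>" "\<alpha> \<le> (2 - \<tau>) * extrapolation_bound I T y w"
  shows "\<alpha> * \<tau> * (\<Sum>i\<in>I. w i * (norm (T i y - y))\<^sup>2)
    \<le> (norm (y - q))\<^sup>2 - (norm (relaxed_op I T w \<alpha> y - q))\<^sup>2"
proof -
  define u where "u = weighted_op I T w y - y"
  define S where "S = (\<Sum>i\<in>I. w i * (norm (T i y - y))\<^sup>2)"
  have inner_ge: "S \<le> inner u (q - y)"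
    unfolding S_def u_def by (rule weighted_op_displacement_inner[OF cut w q])
  have "S \<ge> 0"
    unfolding S_def using w by (intro sum_nonneg) (auto simp: weight_function_def)
  have lam_bound: "\<alpha> * (norm u)\<^sup>2 \<le> (2 - \<tau>) * S"
  proof (cases "u = 0")
    case True
    \<comment> \<open>Here every operator of positive weight fixes \<open>y\<close>, so both sides vanish.\<close>
    with inner_ge \<open>S \<ge> 0\<close> show ?thesis by simp
  next
    case False
    then have "extrapolation_bound I T y w = S / (norm u)\<^sup>2"
      by (simp add: extrapolation_bound_def u_def S_def)
    with lam(2) False show ?thesis by (simp add: field_simps)
  qed
  have "relaxed_op I T w \<alpha> y - q = (y - q) + \<alpha> *\<^sub>R u"
    by (simp add: relaxed_op_def u_def)
  then have "(norm (relaxed_op I T w \<alpha> y - q))\<^sup>2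
      = (norm (y - q))\<^sup>2 - 2 * (\<alpha> * inner u (q - y)) + \<alpha> * (\<alpha> * (norm u)\<^sup>2)"
    by (simp add: power2_norm_eq_inner inner_add_left inner_add_right inner_diff_left
        inner_diff_right inner_commute algebra_simps)
  moreover have "\<alpha> * S \<le> \<alpha> * inner u (q - y)"
    using inner_ge lam(1) by (rule mult_left_mono)
  moreover have "\<alpha> * (\<alpha> * (norm u)\<^sup>2) \<le> \<alpha> * ((2 - \<tau>) * S)"
    using lam_bound lam(1) by (rule mult_left_mono)
  ultimately show ?thesis
    unfolding S_def[symmetric] by (simp add: algebra_simps)
qed

text \<open>
  Approaching two points \<open>q\<close> and \<open>z\<close> constrains a step differently: the difference of the two
  squared-distance decreases is linear in the step.  With \<open>q = z - r v / \<parallel>v\<parallel>\<close>, where \<open>v\<close>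
  is the step, this linear term equals \<open>2 r \<parallel>v\<parallel>\<close>.
\<close>

lemma step_le_decrease:
  fixes y y' z :: "'a::real_inner"
  assumes "r > 0" and closer: "\<And>q. q \<in> cball z r \<Longrightarrow> norm (y' - q) \<le> norm (y - q)"
  shows "2 * r * dist y y' \<le> (norm (y - z))\<^sup>2 - (norm (y' - z))\<^sup>2"
proof (cases "y' = y")
  case False
  define v where "v = y' - y"
  define c where "c = r / norm v"
  define q where "q = z - c *\<^sub>R v"
  have "v \<noteq> 0" using False by (simp add: v_def)
  then have "q \<in> cball z r"
    using \<open>r > 0\<close> by (simp add: q_def c_def dist_norm)
  then have "(norm (y' - q))\<^sup>2 \<le> (norm (y - q))\<^sup>2"
    by (intro power_mono closer) auto
  moreover have "(norm (p - q))\<^sup>2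
      = (norm (p - z))\<^sup>2 + 2 * c * inner (p - z) v + (norm (q - z))\<^sup>2" for p
  proof -
    have "p - q = (p - z) - (q - z)" by simp
    then have "(norm (p - q))\<^sup>2
        = (norm (p - z))\<^sup>2 - 2 * inner (p - z) (q - z) + (norm (q - z))\<^sup>2"
      by (simp only: power2_norm_eq_inner) (simp add: inner_diff_left inner_diff_right inner_commute)
    then show ?thesis
      by (simp add: q_def)
  qed
  ultimately have "2 * c * inner (y' - y) v \<le> (norm (y - z))\<^sup>2 - (norm (y' - z))\<^sup>2"
    by (simp add: inner_diff_left algebra_simps)
  moreover have "2 * c * inner (y' - y) v = 2 * r * norm v"
    using \<open>v \<noteq> 0\<close> by (simp add: c_def v_def[symmetric] power2_eq_square flip: power2_norm_eq_inner)
  ultimately show ?thesis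
    by (simp add: v_def dist_norm norm_minus_commute)
qed simp

text \<open>A potential that pays for the length of every step bounds the length of the whole path.\<close>

lemma convergent_if_dist_le_decrease:
  fixes x :: "nat \<Rightarrow> 'a::complete_space" and g :: "nat \<Rightarrow> real"
  assumes nonneg: "\<And>k. 0 \<le> g k" and step: "\<And>k. dist (x k) (x (Suc k)) \<le> g k - g (Suc k)"
  shows "convergent x"
proof -
  have "decseq g"
    unfolding decseq_Suc_iff using order_trans[OF zero_le_dist step] by simp
  then have "Cauchy g"
    using nonneg by (auto elim!: decseq_convergent intro: LIMSEQ_imp_Cauchy)
  have dist_le: "dist (x a) (x (a + n)) \<le> g a - g (a + n)" for a n
  proof (induction n)
    case (Suc n)
    have "dist (x a) (x (a + Suc n)) \<le> dist (x a) (x (a + n)) + dist (x (a + n)) (x (Suc (a + n)))"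
      using dist_triangle by simp
    with Suc step[of "a + n"] show ?case by simp
  qed simp
  have "Cauchy x"
    unfolding Cauchy_altdef
  proof (intro allI impI)
    fix e :: real
    assume "e > 0"
    with \<open>Cauchy g\<close> obtain M where "\<forall>a\<ge>M. \<forall>b>a. dist (g a) (g b) < e"
      unfolding Cauchy_altdef by blast
    moreover have "dist (x a) (x b) \<le> dist (g a) (g b)" if "a < b" for a b
      using dist_le[of a "b - a"] that by (simp add: dist_real_def)
    ultimately show "\<exists>M. \<forall>a\<ge>M. \<forall>b>a. dist (x a) (x b) < e"
      by (meson order.strict_trans1)
  qed
  then show ?thesis by (rule Cauchy_convergent)
qed

lemma summable_if_le_decrease:
  fixes a g :: "nat \<Rightarrow> real"
  assumes "\<And>k. 0 \<le> a k" "\<And>k. 0 \<le> g k" and step: "\<And>k. a k \<le> g k - g (Suc k)"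
  shows "summable a"
proof (rule summableI_nonneg_bounded)
  show "(\<Sum>k<n. a k) \<le> g 0" for n
  proof -
    have "(\<Sum>k<n. a k) \<le> (\<Sum>k<n. g k - g (Suc k))"
      by (intro sum_mono step)
    also have "\<dots> = g 0 - g n"
      by (rule sum_lessThan_telescope')
    also have "\<dots> \<le> g 0"
      using assms(2)[of n] by simp
    finally show ?thesis .
  qed
qed (rule assms(1))

text \<open>
  A limit away from zero would make \<open>w\<close> eventually dominated by a multiple of the summable
  products.
\<close>

lemma limit_zero_if_weighted_summable:
  fixes w d :: "nat \<Rightarrow> real"
  assumes w: "\<And>k. 0 \<le> w k" and divergent: "filterlim (\<lambda>n. \<Sum>k<n. w k) at_top sequentially"
    and summable: "summable (\<lambda>k. w k * d k)" and lim: "d \<longlonglongrightarrow> l" and "0 \<le> l"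
  shows "l = 0"
proof (rule ccontr)
  assume "l \<noteq> 0"
  with \<open>0 \<le> l\<close> have "l / 2 > 0" "l / 2 < l" by auto
  have "\<forall>\<^sub>F k in sequentially. l / 2 < d k"
    using lim \<open>l / 2 < l\<close> by (rule order_tendstoD(1))
  then have "\<forall>\<^sub>F k in sequentially. norm (w k) \<le> w k * d k / (l / 2)"
  proof eventually_elim
    case (elim k)
    then have "w k * (l / 2) \<le> w k * d k"
      using w by (intro mult_left_mono) auto
    then show ?case
      using \<open>l / 2 > 0\<close> w[of k] by (simp add: pos_le_divide_eq)
  qed
  moreover have "summable (\<lambda>k. w k * d k / (l / 2))"
    using summable by (rule summable_divide)
  ultimately have "summable w"
    by (rule summable_comparison_test_ev)
  then have "(\<lambda>n. \<Sum>k<n. w k) \<longlonglongrightarrow> suminf w"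
    by (rule summable_LIMSEQ)
  with filterlim_at_top_imp_at_infinity[OF divergent] show False
    using not_tendsto_and_filterlim_at_infinity[OF sequentially_bot] by blast
qed

theorem theorem4p15:
  fixes T :: "nat \<Rightarrow> 'a::{real_inner, complete_space} \<Rightarrow> 'a"
    and m :: nat
    and I :: "nat set"
    and F :: "'a set"
    and w :: "nat \<Rightarrow> nat \<Rightarrow> real"
    and \<tau>\<^sub>1 \<tau>\<^sub>2 :: real
    and lam :: "nat \<Rightarrow> real"
    and x :: "nat \<Rightarrow> 'a"
  assumes finite_dim: "\<exists>B::'a set. finite B \<and> span B = UNIV"
    and m: "m \<ge> 1"
    and I: "I = {1..m}"
    and cutters: "\<And>i. i \<in> I \<Longrightarrow> cutter (T i)"
    and continuous: "\<And>i. i \<in> I \<Longrightarrow> continuous_on UNIV (T i)"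
    and F: "F = (\<Inter>i\<in>I. Fix (T i))"
    and F_nonempty: "F \<noteq> {}"
    and weights: "\<And>k. weight_function I (w k)"
    and tau1: "\<tau>\<^sub>1 \<in> {0<..1}"
    and tau2: "\<tau>\<^sub>2 \<in> {0<..1}"
    and lambda: "\<And>k. lam k \<in> {\<tau>\<^sub>1..(2 - \<tau>\<^sub>2) * extrapolation_bound I T (x k) (w k)}"
    and iteration: "\<And>k. x (Suc k) = relaxed_op I T (w k) (lam k) (x k)"
    and interior: "interior F \<noteq> {}"
    and divergent: "\<And>i. i \<in> I \<Longrightarrow> filterlim (\<lambda>n. \<Sum>k<n. w k i) at_top sequentially"
  shows "\<exists>x'\<in>F. x \<longlonglongrightarrow> x'"
proof -
  define S where "S k = (\<Sum>i\<in>I. w k i * (norm (T i (x k) - x k))\<^sup>2)" for k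
  have w_nonneg: "0 \<le> w k i" if "i \<in> I" for k i
    using weights[of k] that by (auto simp: weight_function_def)
  have S_nonneg: "0 \<le> S k" for k
    unfolding S_def by (intro sum_nonneg mult_nonneg_nonneg w_nonneg) auto
  have decrease: "\<tau>\<^sub>1 * \<tau>\<^sub>2 * S k \<le> (norm (x k - q))\<^sup>2 - (norm (x (Suc k) - q))\<^sup>2"
    if "q \<in> F" for k q
  proof -
    have "\<tau>\<^sub>1 * \<tau>\<^sub>2 * S k \<le> lam k * \<tau>\<^sub>2 * S k"
      using lambda[of k] tau2 S_nonneg by (intro mult_right_mono) auto
    also have "\<dots> \<le> (norm (x k - q))\<^sup>2 - (norm (x (Suc k) - q))\<^sup>2"
      unfolding S_def iteration using lambda[of k] tau1 that
      by (intro relaxed_op_decrease cutters weights) (auto simp: F)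
    finally show ?thesis .
  qed
  have closer: "norm (x (Suc k) - q) \<le> norm (x k - q)" if "q \<in> F" for k q
  proof -
    have "0 \<le> \<tau>\<^sub>1 * \<tau>\<^sub>2 * S k"
      using tau1 tau2 S_nonneg by simp
    with decrease[OF that, of k] have "(norm (x (Suc k) - q))\<^sup>2 \<le> (norm (x k - q))\<^sup>2"
      by linarith
    then show ?thesis
      by (rule power2_le_imp_le) simp
  qed
  obtain z r where "r > 0" and ball: "cball z r \<subseteq> F"
    using interior by (auto simp: mem_interior_cball ex_in_conv[symmetric])
  then have "z \<in> F" by auto
  have "dist (x k) (x (Suc k))
      \<le> (norm (x k - z))\<^sup>2 / (2 * r) - (norm (x (Suc k) - z))\<^sup>2 / (2 * r)" for k
  proof -
    have "2 * r * dist (x k) (x (Suc k)) \<le> (norm (x k - z))\<^sup>2 - (norm (x (Suc k) - z))\<^sup>2"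
      using \<open>r > 0\<close> by (rule step_le_decrease) (use closer ball in blast)
    with \<open>r > 0\<close> show ?thesis
      by (simp add: field_simps)
  qed
  then have "convergent x"
    using \<open>r > 0\<close> by (intro convergent_if_dist_le_decrease[where g = "\<lambda>k. (norm (x k - z))\<^sup>2 / (2 * r)"]) auto
  then obtain x' where x': "x \<longlonglongrightarrow> x'"
    by (auto simp: convergent_def)
  have "summable (\<lambda>k. \<tau>\<^sub>1 * \<tau>\<^sub>2 * S k)"
    using tau1 tau2 S_nonneg decrease[OF \<open>z \<in> F\<close>]
    by (intro summable_if_le_decrease[where g = "\<lambda>k. (norm (x k - z))\<^sup>2"]) auto
  then have "summable S"
    using tau1 tau2 by (simp add: summable_cmult_iff)
  have "T i x' = x'" if "i \<in> I" for i
  proof -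
    have "isCont (T i) x'"
      using continuous[OF that] by (simp add: continuous_on_eq_continuous_at)
    then have "(\<lambda>k. T i (x k)) \<longlonglongrightarrow> T i x'"
      using x' by (rule isCont_tendsto_compose)
    then have lim: "(\<lambda>k. (norm (T i (x k) - x k))\<^sup>2) \<longlonglongrightarrow> (norm (T i x' - x'))\<^sup>2"
      by (intro tendsto_intros x')
    have "w k i * (norm (T i (x k) - x k))\<^sup>2 \<le> S k" for k
      unfolding S_def using that w_nonneg by (intro member_le_sum) (auto simp: I)
    then have "summable (\<lambda>k. w k i * (norm (T i (x k) - x k))\<^sup>2)"
      using w_nonneg[OF that] by (intro summable_comparison_test'[OF \<open>summable S\<close>]) auto
    from limit_zero_if_weighted_summable[OF w_nonneg[OF that] divergent[OF that] this lim]
    show ?thesis by simp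
  qed
  with x' show ?thesis
    by (auto simp: F Fix_def)
qed

end
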